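(* Let $n\ge 2$. The rewriting relation $\rightarrowtail_{\mathrm{full}}$ on head normal forms, generated by the rules below (applied to subterms), is terminating and confluent. Here $x,x'$ range over variables and $y,y_i,z_j$ over head normal forms, and $1\le i\le n$: $(r_2)$ $q(x,y,\dots,y)\rightarrowtail y$; $(r_3)$ $q(x,\mathsf e_1,\dots,\mathsf e_n)\rightarrowtail x$; $(r_4^i)$ $q(x,y_1,\dots,y_{i-1},x,y_{i+1},\dots,y_n)\rightarrowtail q(x,y_1,\dots,y_{i-1},\mathsf e_i,y_{i+1},\dots,y_n)$; $(r_5^i)$ $q(x,y_1,\dots,y_{i-1},q(x,z_1,\dots,z_n),y_{i+1},\dots,y_n)\rightarrowtail q(x,y_1,\dots,y_{i-1},z_i,y_{i+1},\dots,y_n)$; $(r_6^i)$ if $x'<x$: $q(x,y_1,\dots,y_{i-1},q(x',z_1,\dots,z_n),y_{i+1},\dots,y_n)\rightarrowtail q(x',q(x,y_1,\dots,y_{i-1},z_1,y_{i+1},\dots,y_n),\dots,q(x,y_1,\dots,y_{i-1},z_n,y_{i+1},\dots,y_n))$; $(r_7^i)$ if $x'<x$: $q(x,y_1,\dots,y_{i-1},x',y_{i+1},\dots,y_n)\rightarrowtail q(x',q(x,y_1,\dots,y_{i-1},\mathsf e_1,y_{i+1},\dots,y_n),\dots,q(x,y_1,\dots,y_{i-1},\mathsf e_n,y_{i+1},\dots,y_n))$.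
   Context: $\nu_n$ is the type with one $(n+1)$-ary symbol $q$ and constants $\mathsf e_1,\dots,\mathsf e_n$. The variables are $x_1,x_2,x_3,\dots$, totally ordered by $x_1<x_2<x_3<\cdots$. Head normal forms are the $\nu_n$-terms generated by the grammar $t,t_i::=\mathsf e_i\mid x\mid q(x,t_1,\dots,t_n)$ with $x$ a variable (so the first argument of every occurrence of $q$ is a variable). Terminating means there is no infinite rewrite sequence; confluent means any two terms reachable from a common term by rewriting can be rewritten to a common term. *)

theory Defs
  imports Main "HOL-Library.Confluence"
begin

text \<open>All indices are shifted by one so that they agree with list positions: \<open>Var k\<close> is the
  variable \<open>x\<^sub>k\<^sub>+\<^sub>1\<close>, \<open>Cst i\<close> is the constant \<open>e\<^sub>i\<^sub>+\<^sub>1\<close>, and \<open>Q t [t\<^sub>1, ..., t\<^sub>n]\<close> is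
  \<open>q(t, t\<^sub>1, ..., t\<^sub>n)\<close>. The order on variables is the order of their indices.\<close>

datatype trm = Var nat | Cst nat | Q trm "trm list"

inductive_set nu_terms :: "nat \<Rightarrow> trm set" for n :: nat where
  "Var x \<in> nu_terms n"
| "i < n \<Longrightarrow> Cst i \<in> nu_terms n"
| "t \<in> nu_terms n \<Longrightarrow> length ts = n \<Longrightarrow> \<forall>u\<in>set ts. u \<in> nu_terms n \<Longrightarrow> Q t ts \<in> nu_terms n"

inductive_set hnf :: "nat \<Rightarrow> trm set" for n :: nat where
  hnf_Var: "Var x \<in> hnf n"
| hnf_Cst: "i < n \<Longrightarrow> Cst i \<in> hnf n"
| hnf_Q: "length ts = n \<Longrightarrow> \<forall>u\<in>set ts. u \<in> hnf n \<Longrightarrow> Q (Var x) ts \<in> hnf n"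

lemma hnf_nu_terms: "hnf n \<subseteq> nu_terms n"
proof
  fix t assume "t \<in> hnf n"
  then show "t \<in> nu_terms n"
    by induction (auto intro: nu_terms.intros)
qed

definition hnf_args :: "nat \<Rightarrow> trm list \<Rightarrow> bool" where
  "hnf_args n ts \<longleftrightarrow> length ts = n \<and> set ts \<subseteq> hnf n"

text \<open>The entry of \<open>ys\<close> at position \<open>i\<close> is irrelevant in the last four rules, as it is always
  overwritten.\<close>

inductive root_step :: "nat \<Rightarrow> trm \<Rightarrow> trm \<Rightarrow> bool" for n :: nat where
  r2: "y \<in> hnf n \<Longrightarrow> root_step n (Q (Var x) (replicate n y)) y"
| r3: "root_step n (Q (Var x) (map Cst [0..<n])) (Var x)"
| r4: "\<lbrakk>i < n; hnf_args n ys\<rbrakk> \<Longrightarrow>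
    root_step n (Q (Var x) (ys[i := Var x])) (Q (Var x) (ys[i := Cst i]))"
| r5: "\<lbrakk>i < n; hnf_args n ys; hnf_args n zs\<rbrakk> \<Longrightarrow>
    root_step n (Q (Var x) (ys[i := Q (Var x) zs])) (Q (Var x) (ys[i := zs ! i]))"
| r6: "\<lbrakk>i < n; hnf_args n ys; hnf_args n zs; x' < x\<rbrakk> \<Longrightarrow>
    root_step n (Q (Var x) (ys[i := Q (Var x') zs]))
                (Q (Var x') (map (\<lambda>z. Q (Var x) (ys[i := z])) zs))"
| r7: "\<lbrakk>i < n; hnf_args n ys; x' < x\<rbrakk> \<Longrightarrow>
    root_step n (Q (Var x) (ys[i := Var x']))
                (Q (Var x') (map (\<lambda>j. Q (Var x) (ys[i := Cst j])) [0..<n]))"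

text \<open>No closure under the first argument of \<open>Q\<close> is needed: in a head normal form it is a
  variable, and no rule rewrites a variable.\<close>

inductive rw_full :: "nat \<Rightarrow> trm \<Rightarrow> trm \<Rightarrow> bool" for n :: nat where
  rw_root: "root_step n s t \<Longrightarrow> rw_full n s t"
| rw_arg: "\<lbrakk>rw_full n s t; i < n; hnf_args n ys\<rbrakk> \<Longrightarrow>
    rw_full n (Q (Var x) (ys[i := s])) (Q (Var x) (ys[i := t]))"

lemma hnf_Q_iff: "Q (Var x) ts \<in> hnf n \<longleftrightarrow> hnf_args n ts"
  by (auto simp: hnf_args_def intro: hnf_Q elim: hnf.cases)

lemma hnf_args_update: "hnf_args n ys \<Longrightarrow> t \<in> hnf n \<Longrightarrow> hnf_args n (ys[i := t])"
  unfolding hnf_args_def using set_update_subset_insert[of ys i t] by auto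

lemma hnf_args_map:
  "length xs = n \<Longrightarrow> (\<And>x. x \<in> set xs \<Longrightarrow> f x \<in> hnf n) \<Longrightarrow> hnf_args n (map f xs)"
  by (auto simp: hnf_args_def)

lemma root_step_hnf: "root_step n s t \<Longrightarrow> s \<in> hnf n \<and> t \<in> hnf n"
proof (induction rule: root_step.induct)
  case (r2 y x)
  then show ?case by (auto simp: hnf_Q_iff hnf_args_def)
next
  case (r5 i ys zs x)
  then have "zs ! i \<in> hnf n" by (auto simp: hnf_args_def)
  with r5 show ?case by (simp add: hnf_Q_iff hnf_args_update)
next
  case (r6 i ys zs x' x)
  then have "z \<in> hnf n" if "z \<in> set zs" for z using that by (auto simp: hnf_args_def)
  moreover have "length zs = n" using r6 by (simp add: hnf_args_def)
  ultimately show ?case using r6 by (auto simp: hnf_Q_iff intro!: hnf_args_update hnf_args_map)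
qed (auto simp: hnf_Q_iff intro!: hnf_args_update hnf_args_map hnf_Var hnf_Cst)

lemma rw_full_hnf: "rw_full n s t \<Longrightarrow> s \<in> hnf n \<and> t \<in> hnf n"
  by (induction rule: rw_full.induct) (auto simp: root_step_hnf hnf_Q_iff hnf_args_update)

definition terminating :: "('a \<Rightarrow> 'a \<Rightarrow> bool) \<Rightarrow> bool" where
  "terminating R \<longleftrightarrow> \<not> (\<exists>f :: nat \<Rightarrow> 'a. \<forall>k. R (f k) (f (Suc k)))"

end

theory Submission
  imports Defs
begin

text \<open>Termination: an Ackermann-like function \<open>A\<^sub>x\<close>, tailored so that
  \<open>A\<^sub>x (S + 1) > A\<^sub>y (n \<sqdot> A\<^sub>x S)\<close> for \<open>y < x\<close>, interprets \<open>q(x, t\<^sub>1, ..., t\<^sub>n)\<close> as \<open>A\<^sub>x\<close> of the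
  sum of the weights of the \<open>t\<^sub>i\<close>; this inequality pays for the duplication in the rules
  \<open>r\<^sub>6\<close> and \<open>r\<^sub>7\<close>, and every step lowers the weight.

  Confluence: evaluate a term under environments that send variables to \<open>{0, ..., n - 1}\<close>, reading
  \<open>q\<close> as case distinction. Rewriting preserves the value, and normal forms are reduced
  ordered decision trees, which are determined by the function they compute.\<close>

section \<open>Termination\<close>

text \<open>The third clause makes the dominating inequality hold for adjacent indices by
  definition. The offset 2 lets every \<open>Q\<close> term with a variable head outweigh a
  variable, as \<open>r3\<close> requires.\<close>

fun ack :: "nat \<Rightarrow> nat \<Rightarrow> nat \<Rightarrow> nat" where
  "ack n 0 s = s + 2"
| "ack n (Suc x) 0 = 2"
| "ack n (Suc x) (Suc s) = Suc (ack n x (n * ack n (Suc x) s))"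

lemma ack_ge: "n \<ge> 1 \<Longrightarrow> s + 2 \<le> ack n x s"
proof (induction n x s rule: ack.induct)
  case (3 n x s)
  then have "s + 2 \<le> n * ack n (Suc x) s"
    by (metis le_trans mult_le_mono1 nat_mult_1)
  with 3 show ?case by simp
qed auto

lemma ack_strict_mono:
  assumes "n \<ge> 1" shows "strict_mono (ack n x)"
proof (cases x)
  case (Suc y)
  have "ack n x s < ack n x (Suc s)" for s
  proof -
    have "ack n x s \<le> n * ack n x s" using assms by simp
    also have "\<dots> < ack n x (Suc s)"
      using ack_ge[OF assms, of "n * ack n x s" y] by (simp add: Suc)
    finally show ?thesis .
  qed
  then show ?thesis by (simp add: strict_mono_Suc_iff)
qed (auto simp: strict_mono_def)

lemma ack_mono: "n \<ge> 1 \<Longrightarrow> s \<le> t \<Longrightarrow> ack n x s \<le> ack n x t"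
  using ack_strict_mono[of n x] by (simp add: strict_mono_less_eq)

lemma ack_less: "n \<ge> 1 \<Longrightarrow> s < t \<Longrightarrow> ack n x s < ack n x t"
  using ack_strict_mono[of n x] by (simp add: strict_mono_less)

text \<open>Adjacent indices suffice. At \<open>Suc r\<close> the upper level applies the lower one
  to \<open>n * ack n (Suc x) r\<close>, which is at least \<open>Suc r\<close>.\<close>

lemma ack_mono_index:
  assumes "n \<ge> 1" "x \<le> y" shows "ack n x s \<le> ack n y s"
proof -
  have "ack n x s \<le> ack n (Suc x) s" for x
  proof (cases s)
    case 0
    then show ?thesis by (cases x) auto
  next
    case (Suc r)
    have "Suc r \<le> ack n (Suc x) r" using ack_ge[OF assms(1), of r "Suc x"] by simp
    also have "\<dots> \<le> n * ack n (Suc x) r" using assms(1) by simp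
    finally have "ack n x (Suc r) \<le> ack n x (n * ack n (Suc x) r)"
      using assms(1) ack_mono by blast
    then show ?thesis by (simp add: Suc)
  qed
  then show ?thesis using lift_Suc_mono_le[of "\<lambda>x. ack n x s"] assms(2) by blast
qed

text \<open>Raise \<open>y\<close> to the predecessor of \<open>x\<close>, where the claim for
  \<open>Suc s\<close> is the defining equation, then use monotonicity up to
  \<open>t\<close>.\<close>

lemma ack_dominates:
  assumes "n \<ge> 1" "y < x" "s < t" shows "ack n y (n * ack n x s) < ack n x t"
proof -
  obtain z where x: "x = Suc z" "y \<le> z" using assms(2) by (cases x) auto
  have "ack n y (n * ack n x s) \<le> ack n z (n * ack n x s)"
    using assms(1) x(2) by (rule ack_mono_index)
  also have "\<dots> < ack n x (Suc s)" by (simp add: x)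
  also have "\<dots> \<le> ack n x t" using assms by (intro ack_mono) auto
  finally show ?thesis .
qed

text \<open>The gap between variables (1) and constants (0) makes \<open>r4\<close> decrease and
  leaves the slack that \<open>r7\<close> spends. The last clause is a default for terms outside
  \<open>hnf\<close>.\<close>

fun weight :: "nat \<Rightarrow> trm \<Rightarrow> nat" where
  "weight n (Var x) = 1"
| "weight n (Cst i) = 0"
| "weight n (Q (Var x) ts) = ack n x (sum_list (map (weight n) ts))"
| "weight n (Q _ ts) = 0"

text \<open>\<open>A\<close> is the contribution of the other positions, so a rewrite at position
  \<open>i\<close> is judged by that single summand.\<close>

lemma sum_list_map_update:
  fixes f :: "'a \<Rightarrow> nat"
  assumes "i < length ys"
  obtains A where "\<And>s. sum_list (map f (ys[i := s])) = A + f s"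
proof
  fix s
  show "sum_list (map f (ys[i := s])) = (sum_list (map f (take i ys)) + sum_list (map f (drop (Suc i) ys))) + f s"
    using assms by (simp add: upd_conv_take_nth_drop)
qed

lemma sum_list_le_length_mult:
  fixes f :: "'a \<Rightarrow> nat"
  shows "(\<And>x. x \<in> set xs \<Longrightarrow> f x \<le> b) \<Longrightarrow> sum_list (map f xs) \<le> length xs * b"
  by (induction xs) (auto intro: add_mono)

lemma root_step_weight:
  assumes "n \<ge> 1" "root_step n s t" shows "weight n t < weight n s"
  using assms(2)
proof cases
  case (r2 x)
  have "weight n t \<le> n * weight n t" using assms(1) by simp
  also have "\<dots> < weight n s"
    using ack_ge[OF assms(1), of "n * weight n t" x] by (simp add: r2 sum_list_replicate)
  finally show ?thesis .
next
  case (r3 x)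
  have "1 < s + 2" for s :: nat by simp
  also have "s + 2 \<le> ack n x s" for s using assms(1) by (rule ack_ge)
  finally show ?thesis by (simp add: r3 del: One_nat_def)
next
  case (r4 i ys x)
  then obtain A where "\<And>s. sum_list (map (weight n) (ys[i := s])) = A + weight n s"
    using sum_list_map_update[of i ys] by (metis hnf_args_def)
  with r4 assms(1) show ?thesis by (simp add: ack_less)
next
  case (r5 i ys zs x)
  then obtain A where A: "\<And>s. sum_list (map (weight n) (ys[i := s])) = A + weight n s"
    using sum_list_map_update[of i ys] by (metis hnf_args_def)
  have "weight n (zs ! i) \<le> sum_list (map (weight n) zs)"
    using r5 by (intro member_le_sum_list) (auto simp: hnf_args_def)
  also have "\<dots> < weight n (Q (Var x) zs)"
    using ack_ge[OF assms(1), of "sum_list (map (weight n) zs)" x] by simp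
  finally show ?thesis using r5 assms(1) A by (simp add: ack_less)
next
  case (r6 i ys zs y x)
  then obtain A where A: "\<And>s. sum_list (map (weight n) (ys[i := s])) = A + weight n s"
    using sum_list_map_update[of i ys] by (metis hnf_args_def)
  let ?Z = "sum_list (map (weight n) zs)"
  \<comment> \<open>Bounding each \<open>z\<close> by the total \<open>?Z\<close> gives all
    \<open>n\<close> copies of the context one common bound. Since \<open>?Z < ack n y ?Z\<close>,
    domination then applies.\<close>
  have "weight n (Q (Var x) (ys[i := z])) \<le> ack n x (A + ?Z)" if "z \<in> set zs" for z
    using that assms(1) by (auto simp: A intro!: ack_mono member_le_sum_list)
  then have "sum_list (map (weight n \<circ> (\<lambda>z. Q (Var x) (ys[i := z]))) zs) \<le> n * ack n x (A + ?Z)"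
    using sum_list_le_length_mult[of zs] r6 by (auto simp: hnf_args_def)
  then have "weight n t \<le> ack n y (n * ack n x (A + ?Z))"
    using assms(1) r6 by (simp add: ack_mono)
  also have "\<dots> < ack n x (A + ack n y ?Z)"
    using assms(1) r6 ack_ge[OF assms(1), of ?Z y] by (intro ack_dominates) auto
  finally show ?thesis using r6 A by simp
next
  case (r7 i ys y x)
  then obtain A where A: "\<And>s. sum_list (map (weight n) (ys[i := s])) = A + weight n s"
    using sum_list_map_update[of i ys] by (metis hnf_args_def)
  \<comment> \<open>The substituted constants weigh 0, so each of the \<open>n\<close> copies weighs
    exactly \<open>ack n x A\<close>.\<close>
  have "weight n t = ack n y (n * ack n x A)"
    using r7 A by (simp add: comp_def sum_list_triv)
  also have "\<dots> < ack n x (A + 1)"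
    using assms(1) r7 by (intro ack_dominates) auto
  finally show ?thesis using r7 A by simp
qed

lemma rw_full_weight:
  assumes "n \<ge> 1" "rw_full n s t" shows "weight n t < weight n s"
  using assms(2)
proof induction
  case (rw_root s t)
  then show ?case using assms(1) root_step_weight by blast
next
  case (rw_arg s t i ys x)
  then obtain A where "\<And>s. sum_list (map (weight n) (ys[i := s])) = A + weight n s"
    using sum_list_map_update[of i ys] by (metis hnf_args_def)
  with rw_arg assms(1) show ?case by (simp add: ack_less)
qed

section \<open>Consequences of a decreasing measure\<close>

lemma terminating_if_decreasing:
  fixes f :: "'a \<Rightarrow> nat"
  assumes "\<And>s t. R s t \<Longrightarrow> f t < f s"
  shows "terminating R"
  unfolding terminating_def
proof
  assume "\<exists>g. \<forall>k. R (g k) (g (Suc k))"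
  then obtain g where "\<forall>k. R (g k) (g (Suc k))" ..
  then have "\<forall>k. (g (Suc k), g k) \<in> measure f" using assms by simp
  then show False using wf_measure[of f] unfolding wf_iff_no_infinite_down_chain by blast
qed

lemma ex_normal_form:
  fixes f :: "'a \<Rightarrow> nat"
  assumes "\<And>s t. R s t \<Longrightarrow> f t < f s"
  shows "\<exists>t. R\<^sup>*\<^sup>* s t \<and> (\<forall>u. \<not> R t u)"
proof (induction "f s" arbitrary: s rule: less_induct)
  case less
  show ?case
  proof (cases "\<exists>t. R s t")
    case True
    then obtain t where "R s t" ..
    then show ?thesis using less assms converse_rtranclp_into_rtranclp by metis
  qed auto
qed

section \<open>Confluence\<close>

text \<open>Positions count from 0, so the value of a constant is the branch it selects. Selection
  stays in range only for environments with values below \<open>n\<close>, hence that restriction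
  later.\<close>

fun sem :: "(nat \<Rightarrow> nat) \<Rightarrow> trm \<Rightarrow> nat" where
  "sem \<rho> (Var x) = \<rho> x"
| "sem \<rho> (Cst i) = i"
| "sem \<rho> (Q t ts) = map (sem \<rho>) ts ! sem \<rho> t"

text \<open>Each rule is a law of case distinction: a test with equal branches (\<open>r2\<close>),
  a test returning its own outcome (\<open>r3\<close>), a repeated test (\<open>r4\<close>,
  \<open>r5\<close>), or an exchange of two tests (\<open>r6\<close>, \<open>r7\<close>).\<close>

lemma root_step_sem:
  assumes "\<forall>x. \<rho> x < n" "root_step n s t" shows "sem \<rho> s = sem \<rho> t"
proof -
  have "\<rho> x < n" for x using assms(1) by simp
  with assms(2) show ?thesis
    by cases (simp_all add: hnf_args_def nth_list_update)
qed

lemma rw_full_sem: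
  assumes "\<forall>x. \<rho> x < n" "rw_full n s t" shows "sem \<rho> s = sem \<rho> t"
  using assms(2) 
proof induction
  case (rw_root s t)
  with assms(1) show ?case by (rule root_step_sem)
next
  case (rw_arg s t i ys x)
  then show ?case by (simp add: map_update)
qed

lemma rtranclp_rw_full_sem:
  assumes "\<forall>x. \<rho> x < n" "(rw_full n)\<^sup>*\<^sup>* s t" shows "sem \<rho> s = sem \<rho> t"
  using assms(2) 
  by induction (simp_all add: rw_full_sem[OF assms(1)])

section \<open>Normal forms as reduced ordered decision trees\<close>

definition normal :: "nat \<Rightarrow> trm \<Rightarrow> bool" where
  "normal n t \<longleftrightarrow> t \<in> hnf n \<and> (\<forall>u. \<not> rw_full n t u)"

text \<open>Only the root variable is inspected; in normal terms the bound passes to all subterms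
  through \<open>normal_Q\<close>.\<close>

fun above :: "nat \<Rightarrow> trm \<Rightarrow> bool" where
  "above x (Var y) \<longleftrightarrow> x < y"
| "above x (Cst i) \<longleftrightarrow> True"
| "above x (Q (Var y) ts) \<longleftrightarrow> x < y"
| "above x (Q _ ts) \<longleftrightarrow> False"

lemma above_trans: "above y t \<Longrightarrow> x < y \<Longrightarrow> above x t"
  by (induction y t rule: above.induct) auto

text \<open>Any violation exposes a redex: equal branches for \<open>r2\<close>, the list of
  constants for \<open>r3\<close>, a child headed by \<open>x\<close> for \<open>r4\<close> or
  \<open>r5\<close>, and one headed by a smaller variable for \<open>r6\<close> or
  \<open>r7\<close>.\<close>

lemma normal_Q:
  assumes "normal n (Q (Var x) ts)"
  shows "length ts = n" "\<forall>u\<in>set ts. normal n u \<and> above x u"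
    "\<forall>y. ts \<noteq> replicate n y" "ts \<noteq> map Cst [0..<n]"
proof -
  have args: "hnf_args n ts" and irred: "\<not> rw_full n (Q (Var x) ts) u" for u
    using assms by (auto simp: normal_def hnf_Q_iff)
  show len: "length ts = n" using args by (simp add: hnf_args_def)
  show "ts \<noteq> map Cst [0..<n]"
    using irred rw_root[OF r3[of n x]] by auto
  show "\<forall>y. ts \<noteq> replicate n y"
  proof (intro allI notI)
    fix y assume ts: "ts = replicate n y"
    show False
    proof (cases "n = 0")
      case True
      then show False using \<open>ts \<noteq> map Cst [0..<n]\<close> len by simp
    next
      case False
      then have "y \<in> hnf n" using args ts by (simp add: hnf_args_def)
      then show False using irred rw_root[OF r2, of y n x] ts by auto
    qed
  qed
  show "\<forall>u\<in>set ts. normal n u \<and> above x u"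
  proof
    fix u assume "u \<in> set ts"
    then obtain i where i: "i < n" "u = ts ! i" by (metis len in_set_conv_nth)
    \<comment> \<open>As an update of itself, \<open>ts\<close> matches the left-hand sides of the
      rules.\<close>
    then have upd: "ts = ts[i := u]" by simp
    have u: "u \<in> hnf n" using \<open>u \<in> set ts\<close> args by (auto simp: hnf_args_def)
    have "\<not> rw_full n u v" for v
      using irred rw_arg[OF _ i(1) args, of u v x] upd by metis
    moreover from u have "above x u"
    proof cases
      case (hnf_Var y)
      show ?thesis
      proof (rule ccontr)
        assume "\<not> above x u"
        then consider "y = x" | "y < x" using hnf_Var by fastforce
        then show False
          using irred rw_root[OF r4[OF i(1) args, of x]] rw_root[OF r7[OF i(1) args, of y x]]
            upd hnf_Var by cases metis+
      qed
    next
      case (hnf_Q zs y)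
      then have zs: "hnf_args n zs" by (auto simp: hnf_args_def)
      show ?thesis
      proof (rule ccontr)
        assume "\<not> above x u"
        then consider "y = x" | "y < x" using hnf_Q by fastforce
        then show False
          using irred rw_root[OF r5[OF i(1) args zs, of x]] rw_root[OF r6[OF i(1) args zs, of y x]]
            upd hnf_Q by cases metis+
      qed
    qed simp
    ultimately show "normal n u \<and> above x u" using u by (simp add: normal_def)
  qed
qed

text \<open>Variables increase along every branch of a normal term, so \<open>x\<close>, being below
  the root, occurs nowhere in it.\<close>

lemma sem_above_update:
  assumes "normal n t" "above x t" "\<forall>y. \<rho> y < n"
  shows "sem (\<rho>(x := a)) t = sem \<rho> t"
proof -
  have "t \<in> hnf n" using assms(1) by (simp add: normal_def)
  then show ?thesis using assms(1,2)
  proof induction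
    case (hnf_Q ts y)
    have "sem (\<rho>(x := a)) u = sem \<rho> u" if "u \<in> set ts" for u
    proof -
      have "normal n u" "above x u"
        using that hnf_Q.prems normal_Q(2)[OF hnf_Q.prems(1)] above_trans[of y u x] by auto
      then show ?thesis using that hnf_Q.IH by blast
    qed
    then have "sem (\<rho>(x := a)) (ts ! \<rho> y) = sem \<rho> (ts ! \<rho> y)"
      using hnf_Q.hyps assms(3) by simp
    then show ?case using hnf_Q.hyps hnf_Q.prems(2) assms(3) by (simp add: fun_upd_def)
  qed auto
qed

section \<open>Normal forms are determined by the function they compute\<close>

definition same_sem :: "nat \<Rightarrow> trm \<Rightarrow> trm \<Rightarrow> bool" where
  "same_sem n s t \<longleftrightarrow> (\<forall>\<rho>. (\<forall>x. \<rho> x < n) \<longrightarrow> sem \<rho> s = sem \<rho> t)"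

lemma same_sem_sym: "same_sem n s t \<Longrightarrow> same_sem n t s"
  by (simp add: same_sem_def)

lemma sem_Q_branch:
  assumes "normal n (Q (Var x) ts)" "i < n" "\<forall>y. \<rho> y < n"
  shows "sem (\<rho>(x := i)) (Q (Var x) ts) = sem \<rho> (ts ! i)"
  using assms normal_Q(1,2)[OF assms(1)] sem_above_update[of n "ts ! i" x \<rho> i] by simp

text \<open>If the root variable did not matter, all branches would compute the same function, hence
  coincide by \<open>IH\<close>, against irreducibility under \<open>r2\<close>. Uniqueness for
  branches is assumed as \<open>IH\<close> so that the later induction can supply it.\<close>

lemma normal_Q_not_independent:
  assumes "normal n (Q (Var x) ts)"
    and IH: "\<And>u v. \<lbrakk>u \<in> set ts; v \<in> set ts; same_sem n u v\<rbrakk> \<Longrightarrow> u = v"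
    and indep: "\<And>\<rho> i. \<lbrakk>\<forall>y. \<rho> y < n; i < n\<rbrakk> \<Longrightarrow>
      sem (\<rho>(x := i)) (Q (Var x) ts) = sem \<rho> (Q (Var x) ts)"
  shows False
proof -
  note nf = normal_Q[OF assms(1)]
  have "same_sem n (ts ! i) (ts ! j)" if "i < n" "j < n" for i j
    using that indep sem_Q_branch[OF assms(1)] by (simp add: same_sem_def del: sem.simps)
  then have "ts ! i = ts ! 0" if "i < n" for i
    using that IH nf(1) by (metis nth_mem gr_zeroI not_less_zero)
  then have "ts = replicate n (ts ! 0)"
    using nf(1) by (metis length_replicate nth_equalityI nth_replicate)
  then show False using nf(3) by blast
qed

text \<open>With equal roots, compare branch by branch. Otherwise the tree with the larger root
  ignores the smaller root variable, on which the other tree must depend.\<close>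

lemma normal_unique_Q_Q:
  assumes s: "normal n (Q (Var x) ts)" and t: "normal n (Q (Var y) us)"
    and eq: "same_sem n (Q (Var x) ts) (Q (Var y) us)"
    and IH: "\<And>u v. \<lbrakk>u \<in> set ts \<union> set us; v \<in> set ts \<union> set us; same_sem n u v\<rbrakk> \<Longrightarrow> u = v"
  shows "Q (Var x) ts = Q (Var y) us"
proof -
  have upd: "\<forall>z. (\<rho>(x := i)) z < n" if "\<forall>z. \<rho> z < n" "i < n" for \<rho> :: "nat \<Rightarrow> nat" and x i
    using that by simp
  consider "x = y" | "x < y" | "y < x" by linarith
  then show ?thesis
  proof cases
    case 1
    have "same_sem n (ts ! i) (us ! i)" if "i < n" for i
      unfolding same_sem_def
    proof (intro allI impI)
      fix \<rho> :: "nat \<Rightarrow> nat" assume \<rho>: "\<forall>x. \<rho> x < n"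
      then show "sem \<rho> (ts ! i) = sem \<rho> (us ! i)"
        using eq upd[OF \<rho> that, of x] sem_Q_branch[OF s that \<rho>] sem_Q_branch[OF t that \<rho>] 1
        by (simp add: same_sem_def del: sem.simps)
    qed
    then have "ts ! i = us ! i" if "i < n" for i
      using that IH normal_Q(1)[OF s] normal_Q(1)[OF t] by simp
    then show ?thesis using 1 normal_Q(1)[OF s] normal_Q(1)[OF t]
      by (simp add: list_eq_iff_nth_eq)
  next
    case 2
    have False
    proof (rule normal_Q_not_independent[OF s])
      fix \<rho> :: "nat \<Rightarrow> nat" and i assume "\<forall>y. \<rho> y < n" "i < n"
      with upd sem_above_update[OF t, of x \<rho> i] 2 eq
      show "sem (\<rho>(x := i)) (Q (Var x) ts) = sem \<rho> (Q (Var x) ts)"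
        by (simp add: same_sem_def del: sem.simps)
    qed (use IH in auto)
    then show ?thesis ..
  next
    case 3
    have False
    proof (rule normal_Q_not_independent[OF t])
      fix \<rho> :: "nat \<Rightarrow> nat" and i assume \<rho>: "\<forall>y. \<rho> y < n" "i < n"
      with sem_above_update[OF s, of y \<rho> i] 3
      have "sem (\<rho>(y := i)) (Q (Var x) ts) = sem \<rho> (Q (Var x) ts)" by simp
      with upd[OF \<rho>, of y] \<rho> eq show "sem (\<rho>(y := i)) (Q (Var y) us) = sem \<rho> (Q (Var y) us)"
        by (simp add: same_sem_def del: sem.simps)
    qed (use IH in auto)
    then show ?thesis ..
  qed
qed

lemma normal_Q_not_Cst:
  assumes s: "normal n (Q (Var x) ts)"
    and IH: "\<And>u v. \<lbrakk>u \<in> set ts; v \<in> set ts; same_sem n u v\<rbrakk> \<Longrightarrow> u = v"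
  shows "\<not> same_sem n (Q (Var x) ts) (Cst k)"
proof
  assume eq: "same_sem n (Q (Var x) ts) (Cst k)"
  show False
  proof (rule normal_Q_not_independent[OF s IH])
    fix \<rho> :: "nat \<Rightarrow> nat" and i assume "\<forall>y. \<rho> y < n" "i < n"
    then show "sem (\<rho>(x := i)) (Q (Var x) ts) = sem \<rho> (Q (Var x) ts)"
      using eq by (simp add: same_sem_def del: sem.simps(3))
  qed
qed

lemma not_same_sem_Cst_Var:
  assumes "n \<ge> 2" shows "\<not> same_sem n (Cst k) (Var x)"
proof
  assume "same_sem n (Cst k) (Var x)"
  then have "k = i" if "i < n" for i
    using that by (auto simp: same_sem_def dest: spec[of _ "\<lambda>_. i"])
  from this[of 0] this[of 1] assms show False by simp
qed

text \<open>If \<open>y = x\<close>, the branches compute the constants and \<open>r3\<close> would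
  apply. If \<open>y > x\<close>, the tree would not depend on its root variable. If
  \<open>y < x\<close>, the tree ignores \<open>y\<close>, while \<open>Var y\<close> does
  not.\<close>

lemma normal_Q_not_Var:
  assumes "n \<ge> 2" and s: "normal n (Q (Var x) ts)"
    and IH: "\<And>u v. \<lbrakk>u \<in> set ts; v \<in> set ts; same_sem n u v\<rbrakk> \<Longrightarrow> u = v"
    and IH_Cst: "\<And>u i. \<lbrakk>u \<in> set ts; i < n; same_sem n u (Cst i)\<rbrakk> \<Longrightarrow> u = Cst i"
  shows "\<not> same_sem n (Q (Var x) ts) (Var y)"
proof
  assume eq: "same_sem n (Q (Var x) ts) (Var y)"
  consider "x = y" | "x \<noteq> y" "above x (Var y)" | "y < x" by fastforce
  then show False
  proof cases
    case 1
    have "same_sem n (ts ! i) (Cst i)" if "i < n" for i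
      unfolding same_sem_def
    proof (intro allI impI)
      fix \<rho> :: "nat \<Rightarrow> nat" assume \<rho>: "\<forall>x. \<rho> x < n"
      then have "\<forall>z. (\<rho>(x := i)) z < n" using that by simp
      then have "sem (\<rho>(x := i)) (Q (Var x) ts) = i"
        using eq 1 by (simp add: same_sem_def del: sem.simps(3))
      then show "sem \<rho> (ts ! i) = sem \<rho> (Cst i)"
        using sem_Q_branch[OF s that \<rho>] by simp
    qed
    then have "ts ! i = Cst i" if "i < n" for i
      using that IH_Cst normal_Q(1)[OF s] by simp
    then have "ts = map Cst [0..<n]"
      using normal_Q(1)[OF s] by (intro nth_equalityI) auto
    then show False using normal_Q(4)[OF s] by blast
  next
    case 2
    show False
    proof (rule normal_Q_not_independent[OF s IH])
      fix \<rho> :: "nat \<Rightarrow> nat" and i assume "\<forall>y. \<rho> y < n" "i < n"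
      then show "sem (\<rho>(x := i)) (Q (Var x) ts) = sem \<rho> (Q (Var x) ts)"
        using eq 2 by (simp add: same_sem_def del: sem.simps(3))
    qed
  next
    case 3
    then have "above y (Q (Var x) ts)" by simp
    \<comment> \<open>Changing \<open>y\<close> from 0 to \<open>i\<close> leaves the value of the
      tree unchanged; \<open>i = 1\<close>, available as \<open>n \<ge> 2\<close>, gives the
      contradiction.\<close>
    have "i = 0" if "i < n" for i
    proof -
      have 0: "\<forall>z. (\<lambda>_. 0) z < n" using assms(1) by simp
      then have "sem ((\<lambda>_. 0)(y := i)) (Q (Var x) ts) = sem (\<lambda>_. 0) (Q (Var x) ts)"
        using sem_above_update[OF s \<open>above y _\<close>, of "\<lambda>_. 0" i] by blast
      moreover have "sem ((\<lambda>_. 0)(y := i)) (Q (Var x) ts) = i"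
        using eq that by (simp add: same_sem_def del: sem.simps(3))
      moreover have "sem (\<lambda>_. 0) (Q (Var x) ts) = 0"
        using eq 0 by (simp add: same_sem_def del: sem.simps(3))
      ultimately show ?thesis by simp
    qed
    from this[of 1] assms(1) show False by simp
  qed
qed

text \<open>The induction is on the larger of the two sizes because branches must be compared both
  across the two trees and within a single one.\<close>

lemma normal_unique:
  assumes "n \<ge> 2" "normal n s" "normal n t" "same_sem n s t"
  shows "s = t"
  using assms(2-)
proof (induction "max (size s) (size t)" arbitrary: s t rule: less_induct)
  case less
  have small: "size u < size (Q (Var x) ts)" if "u \<in> set ts" for u x ts
    using that by (induction ts) auto
  have IH1: "u = v"
    if "normal n (Q (Var x) ts)" "size (Q (Var x) ts) \<le> max (size s) (size t)"
      "normal n (Q (Var y) us)" "size (Q (Var y) us) \<le> max (size s) (size t)"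
      \<comment> \<open>Taking the two trees equal yields the comparison inside one tree.\<close>
      "u \<in> set ts \<union> set us" "v \<in> set ts \<union> set us" "same_sem n u v" for x ts y us u v
  proof (rule less.hyps)
    have "w \<in> set ts \<union> set us \<Longrightarrow> size w < max (size s) (size t)" for w
      using small[of w ts x] small[of w us y] that(2,4) by auto
    then show "max (size u) (size v) < max (size s) (size t)" using that(5,6) by simp
  qed (use that normal_Q(2)[OF that(1)] normal_Q(2)[OF that(3)] in auto)
  have IH2: "u = Cst i"
    if "normal n (Q (Var x) ts)" "size (Q (Var x) ts) \<le> max (size s) (size t)"
      "u \<in> set ts" "i < n" "same_sem n u (Cst i)" for x ts u i
  proof (rule less.hyps)
    show "max (size u) (size (Cst i)) < max (size s) (size t)"
      using small[OF that(3), of x] that(2) by auto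
    show "normal n (Cst i)"
      using that(4) by (auto simp: normal_def hnf_Cst elim: rw_full.cases root_step.cases)
  qed (use that normal_Q(2)[OF that(1)] in auto)
  have Var: "x = y" if "same_sem n (Var x) (Var y)" for x y
  proof (rule ccontr)
    assume "x \<noteq> y"
    then show False
      using that assms(1) unfolding same_sem_def
      \<comment> \<open>This environment separates \<open>x\<close> from every other
        variable.\<close>
      by (auto dest!: spec[of _ "(\<lambda>_. 0)(x := 1)"])
  qed
  have Cst: "i = j" if "same_sem n (Cst i) (Cst j)" for i j
  proof -
    have "sem (\<lambda>_. 0) (Cst i) = sem (\<lambda>_. 0) (Cst j)"
      using that assms(1) unfolding same_sem_def by fastforce
    then show ?thesis by simp
  qed
  note sym = same_sem_sym[OF less.prems(3)]
  have "s \<in> hnf n" "t \<in> hnf n" using less.prems by (auto simp: normal_def)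
  from this(1) show ?case
  proof cases
    case s: (hnf_Var x)
    from \<open>t \<in> hnf n\<close> show ?thesis
    proof cases
      case (hnf_Var y)
      with s less.prems Var show ?thesis by blast
    next
      case (hnf_Cst j)
      with s sym not_same_sem_Cst_Var[OF assms(1)] show ?thesis by blast
    next
      case (hnf_Q us y)
      have "\<not> same_sem n t (Var x)" unfolding hnf_Q
        by (rule normal_Q_not_Var[OF assms(1)])
          (use less.prems hnf_Q IH1[of y us y us] IH2[of y us] in auto)
      with s sym show ?thesis by simp
    qed
  next
    case s: (hnf_Cst i)
    from \<open>t \<in> hnf n\<close> show ?thesis
    proof cases
      case (hnf_Var y)
      with s less.prems not_same_sem_Cst_Var[OF assms(1)] show ?thesis by blast
    next
      case (hnf_Cst j)
      with s less.prems Cst show ?thesis by blast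
    next
      case (hnf_Q us y)
      have "\<not> same_sem n t (Cst i)" unfolding hnf_Q
        by (rule normal_Q_not_Cst) (use less.prems hnf_Q IH1[of y us y us] in auto)
      with s sym show ?thesis by simp
    qed
  next
    case s: (hnf_Q ts x)
    from \<open>t \<in> hnf n\<close> show ?thesis
    proof cases
      case (hnf_Var y)
      have "\<not> same_sem n s (Var y)" unfolding s
        by (rule normal_Q_not_Var[OF assms(1)])
          (use less.prems s IH1[of x ts x ts] IH2[of x ts] in auto)
      with hnf_Var less.prems show ?thesis by simp
    next
      case (hnf_Cst j)
      have "\<not> same_sem n s (Cst j)" unfolding s
        by (rule normal_Q_not_Cst) (use less.prems s IH1[of x ts x ts] in auto)
      with hnf_Cst less.prems show ?thesis by simp
    next
      case (hnf_Q us y)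
      show ?thesis unfolding s hnf_Q
        by (rule normal_unique_Q_Q) (use less.prems s hnf_Q IH1[of x ts y us] in auto)
    qed
  qed
qed

section \<open>Confluence from unique normal forms\<close>

lemma rtranclp_rw_full_hnf: "(rw_full n)\<^sup>*\<^sup>* s t \<Longrightarrow> s \<in> hnf n \<Longrightarrow> t \<in> hnf n"
  by (induction rule: rtranclp_induct) (auto dest: rw_full_hnf)

lemma confluentp_rw_full:
  assumes "n \<ge> 2" shows "confluentp (rw_full n)"
proof (rule confluentpI)
  fix s a b
  assume a: "(rw_full n)\<^sup>*\<^sup>* s a" and b: "(rw_full n)\<^sup>*\<^sup>* s b"
  show "\<exists>c. (rw_full n)\<^sup>*\<^sup>* a c \<and> (rw_full n)\<^sup>*\<^sup>* b c"
  proof (cases "s \<in> hnf n")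
    case False
    \<comment> \<open>No step starts outside \<open>hnf\<close>, so both reductions are
      empty.\<close>
    then have "a = s" "b = s"
      using a b rw_full_hnf by (metis converse_rtranclpE)+
    then show ?thesis by blast
  next
    case True
    have "rw_full n u v \<Longrightarrow> weight n v < weight n u" for u v
      using rw_full_weight assms by simp
    note nf = ex_normal_form[of "rw_full n" "weight n", OF this]
    obtain a' b' where a': "(rw_full n)\<^sup>*\<^sup>* a a'" "\<forall>u. \<not> rw_full n a' u"
      and b': "(rw_full n)\<^sup>*\<^sup>* b b'" "\<forall>u. \<not> rw_full n b' u"
      using nf[of a] nf[of b] by blast
    have sa: "(rw_full n)\<^sup>*\<^sup>* s a'" and sb: "(rw_full n)\<^sup>*\<^sup>* s b'"
      using a b a' b' by auto
    have "normal n a'" "normal n b'"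
      using rtranclp_rw_full_hnf[OF sa True] rtranclp_rw_full_hnf[OF sb True] a' b'
      by (auto simp: normal_def)
    \<comment> \<open>Both normal forms inherit the value of the common ancestor
      \<open>s\<close>.\<close>
    moreover have "same_sem n a' b'"
      unfolding same_sem_def using rtranclp_rw_full_sem[OF _ sa] rtranclp_rw_full_sem[OF _ sb] by metis
    ultimately have "a' = b'" using normal_unique assms by blast
    then show ?thesis using a' b' by blast
  qed
qed

theorem theorem7p12:
  fixes n :: nat
  assumes "n \<ge> 2"
  shows "terminating (rw_full n) \<and> confluentp (rw_full n)"
proof
  show "terminating (rw_full n)"
    using assms rw_full_weight[of n] by (intro terminating_if_decreasing[where f = "weight n"]) simp
  show "confluentp (rw_full n)" using assms by (rule confluentp_rw_full)
qed

end
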